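(* Let $G$ be the triangular graph in $\mathbb R^2$. For all finite subsets $\Omega$ of the vertices of $G$, $$\frac{(\sharp\overrightarrow{\partial\Omega}-6)^2}{4\sharp\Omega-\sharp\overrightarrow{\partial\Omega}+2}\ge12,$$ and this inequality is sharp, as equality is reached by regular hexagonal shapes $\Omega=H_k$.
   Context: The triangular graph has vertex set the lattice $\Lambda=(1,0)\mathbb Z+\left(\tfrac12,\tfrac{\sqrt3}2\right)\mathbb Z$ and edges connecting nearest neighbours, i.e. points at distance $1$; all edge weights equal $1$. $\sharp$ denotes cardinality, and $\overrightarrow{\partial\Omega}:=\{(x,y):x\in\Omega,\ y\in\Lambda\setminus\Omega,\ |x-y|=1\}$ is the oriented edge-boundary. $H_k$ denotes the perfect hexagon in the triangular grid, where $k$ is the number of graph edges forming each side of the hexagon; for $k\ge0$ one has $\sharp H_k=3k^2+3k+1$ and $\sharp\overrightarrow{\partial H_k}=12k+6$.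
   Formalization: The quotient inequality is stated where 4♯Ω−♯∂Ω+2>0 (two non-adjacent vertices give −18, one vertex 0/0); for all finite Ω it is stated with the denominator cleared. Equality for H_k is as a quotient for k≥1 and in cleared form for k=0. *)

theory Defs
  imports "HOL-Analysis.Analysis"
begin

text \<open>
  The triangular graph: its vertices are the points of \<open>tri_lattice\<close>, its edges join lattice
  points at Euclidean distance 1. The norm of \<open>real \<times> real\<close> is the Euclidean one.
\<close>

definition tri_lattice :: "(real \<times> real) set" where
  "tri_lattice = {of_int a *\<^sub>R (1, 0) + of_int b *\<^sub>R (1 / 2, sqrt 3 / 2) | a b :: int. True}"

definition edge_boundary :: "(real \<times> real) set \<Rightarrow> ((real \<times> real) \<times> (real \<times> real)) set" where
  "edge_boundary \<Omega> = {(x, y). x \<in> \<Omega> \<and> y \<in> tri_lattice - \<Omega> \<and> norm (x - y) = 1}"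

text \<open>
  The perfect hexagon with \<open>k\<close> edges per side, centred at the origin: the lattice points of the
  closed regular hexagon whose corners are \<open>k\<close> times the six neighbours of the origin.
  For \<open>k = 0\<close> it is the single vertex 0.
\<close>

definition hexagon :: "nat \<Rightarrow> (real \<times> real) set" where
  "hexagon k = tri_lattice \<inter> convex hull ((\<lambda>u. real k *\<^sub>R u) ` {u \<in> tri_lattice. norm u = 1})"

end

theory Submission
  imports Defs
begin

text \<open>
  Let \<open>N\<close> be the number of vertices of \<open>\<Omega>\<close> and \<open>P\<close> the number of its boundary edges. Clearing the
  denominator turns the claim into \<open>48 N \<le> P\<^sup>2 + 12\<close>.

  In the integer coordinates given by the lattice basis, the edges run along the three families of
  lines on which \<open>snd\<close>, \<open>fst\<close> and \<open>fst + snd\<close> are constant. Let \<open>b\<close>, \<open>a\<close> and \<open>c\<close> be the numbers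
  of lines of the three families that meet \<open>\<Omega>\<close>. A finite set has an outgoing edge at both ends of
  every line that it meets, so \<open>P \<ge> 2 (a + b + c)\<close> (\<open>card_edge_boundary_ge\<close>).

  It remains to bound \<open>N\<close> in terms of \<open>a\<close>, \<open>b\<close>, \<open>c\<close>. The column of largest \<open>fst\<close> and the row of
  smallest \<open>snd\<close> together form a hook on which \<open>fst + snd\<close> is injective, whence the hook holds at
  most \<open>c\<close> points of the set. Peeling off \<open>t\<close> such hooks leaves a set inside an
  \<open>(a - t) \<times> (b - t)\<close> grid, so \<open>N \<le> c t + (a - t) (b - t)\<close> (\<open>card_le_hooks\<close>). The right-hand side
  is smallest at \<open>t = (a + b - c) / 2\<close>; rounding \<open>t\<close> down to an integer costs at most a quarter, and
  this quarter is exactly the constant in \<open>12 N \<le> (a + b + c)\<^sup>2 + 3\<close>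
  (\<open>hook_bound_imp_isoperimetric\<close>).

  For the hexagon, which is cut out in coordinates by \<open>\<bar>a\<bar>, \<bar>b\<bar>, \<bar>a + b\<bar> \<le> k\<close> (\<open>hexagon_eq\<close>), each
  line is left at most once in each of its two directions, so \<open>P \<le> 6 (2 k + 1)\<close>. The vertex count
  \<open>3 k\<^sup>2 + 3 k + 1\<close> and the inequality just proved force equality.
\<close>

section \<open>Integer coordinates\<close>

definition pt :: "int \<times> int \<Rightarrow> real \<times> real" where
  "pt p = of_int (fst p) *\<^sub>R (1, 0) + of_int (snd p) *\<^sub>R (1 / 2, sqrt 3 / 2)"

definition dirs :: "(int \<times> int) set" where
  "dirs = {(1, 0), (-1, 0), (0, 1), (0, -1), (1, -1), (-1, 1)}"

definition exits :: "(int \<times> int) set \<Rightarrow> int \<times> int \<Rightarrow> (int \<times> int) set" where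
  "exits A d = {p \<in> A. p + d \<notin> A}"

lemma tri_lattice_eq_range_pt: "tri_lattice = range pt"
  unfolding tri_lattice_def pt_def by (auto simp: image_def)

lemma pt_diff: "pt p - pt q = pt (p - q)"
  by (simp add: pt_def algebra_simps diff_divide_distrib)

lemma pt_eq_0_iff: "pt p = 0 \<longleftrightarrow> p = 0"
  by (auto simp: pt_def zero_prod_def prod_eq_iff)

lemma inj_pt: "inj pt"
proof (rule injI)
  fix p q assume "pt p = pt q"
  then have "pt (p - q) = 0" by (simp flip: pt_diff)
  then show "p = q" by (simp add: pt_eq_0_iff)
qed

lemma norm_pt_sq: "(norm (pt (a, b)))\<^sup>2 = of_int (a\<^sup>2 + a * b + b\<^sup>2)"
proof -
  have "(norm (pt (a, b)))\<^sup>2 = (of_int a + of_int b / 2)\<^sup>2 + (of_int b * sqrt 3 / 2)\<^sup>2"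
    by (simp add: pt_def norm_prod_def power_divide)
  also have "\<dots> = of_int (a\<^sup>2 + a * b + b\<^sup>2)"
    by (simp add: field_simps power2_eq_square)
  finally show ?thesis .
qed

lemma norm_pt_eq_1_iff: "norm (pt p) = 1 \<longleftrightarrow> p \<in> dirs"
proof -
  obtain a b where p: "p = (a, b)" by (cases p)
  have "norm (pt p) = 1 \<longleftrightarrow> (norm (pt p))\<^sup>2 = 1"
    by (smt (verit) norm_ge_zero power2_eq_1_iff)
  also have "\<dots> \<longleftrightarrow> a\<^sup>2 + a * b + b\<^sup>2 = 1"
    by (simp only: p norm_pt_sq of_int_eq_1_iff)
  also have "\<dots> \<longleftrightarrow> p \<in> dirs"
  proof
    assume eq: "a\<^sup>2 + a * b + b\<^sup>2 = 1"
    have "(2 * a + b)\<^sup>2 + 3 * b\<^sup>2 = 4" "(2 * b + a)\<^sup>2 + 3 * a\<^sup>2 = 4"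
      using eq by (simp_all add: power2_eq_square algebra_simps)
    then have "b\<^sup>2 \<le> 1" "a\<^sup>2 \<le> 1"
      using zero_le_power2[of "2 * a + b"] zero_le_power2[of "2 * b + a"] by linarith+
    then have "\<bar>a\<bar> \<le> 1" "\<bar>b\<bar> \<le> 1"
      by (simp_all add: abs_square_le_1)
    then have "a = -1 \<or> a = 0 \<or> a = 1" "b = -1 \<or> b = 0 \<or> b = 1" by linarith+
    then show "p \<in> dirs"
      using eq by (auto simp: p dirs_def)
  qed (auto simp: p dirs_def)
  finally show ?thesis .
qed

text \<open>
  Sorting the boundary edges by direction reduces the count to six independent counts of points,
  each of which is governed by a single family of parallel lines.
\<close>

lemma card_edge_boundary_pt:
  assumes "finite A"
  shows "card (edge_boundary (pt ` A)) = (\<Sum>d\<in>dirs. card (exits A d))"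
proof -
  let ?e = "\<lambda>(d, p). (pt p, pt (p + d))"
  have "edge_boundary (pt ` A) = ?e ` (SIGMA d:dirs. exits A d)"
  proof (intro equalityI subsetI)
    fix e assume "e \<in> edge_boundary (pt ` A)"
    then obtain p q where pq: "e = (pt p, pt q)" "p \<in> A" "pt q \<notin> pt ` A" "norm (pt p - pt q) = 1"
      by (auto simp: edge_boundary_def tri_lattice_eq_range_pt)
    then have "q - p \<in> dirs"
      by (metis norm_minus_commute norm_pt_eq_1_iff pt_diff)
    moreover have "p \<in> exits A (q - p)"
      using pq by (auto simp: exits_def)
    ultimately show "e \<in> ?e ` (SIGMA d:dirs. exits A d)"
      using pq(1) by (intro image_eqI[of _ _ "(q - p, p)"]) auto
  next
    fix e assume "e \<in> ?e ` (SIGMA d:dirs. exits A d)"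
    then obtain d p where dp: "e = (pt p, pt (p + d))" "d \<in> dirs" "p \<in> A" "p + d \<notin> A"
      by (auto simp: exits_def)
    then have "norm (pt p - pt (p + d)) = 1"
      by (metis add_diff_cancel_left' norm_minus_commute norm_pt_eq_1_iff pt_diff)
    then show "e \<in> edge_boundary (pt ` A)"
      using dp by (auto simp: edge_boundary_def tri_lattice_eq_range_pt dest: injD[OF inj_pt])
  qed
  moreover have "inj_on ?e (SIGMA d:dirs. exits A d)"
    by (auto simp: inj_on_def dest!: injD[OF inj_pt])
  moreover have "finite dirs" "finite (exits A d)" for d
    using assms by (simp_all add: dirs_def exits_def)
  ultimately show ?thesis
    by (simp add: card_image)
qed

section \<open>Boundary edges and projections\<close>

text \<open>
  The fibres of \<open>f\<close> are unions of lines in direction \<open>d\<close>, and \<open>g\<close> increases along \<open>d\<close>. On each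
  fibre that meets \<open>A\<close>, a point of \<open>A\<close> where \<open>g\<close> is maximal cannot be followed by another one.
\<close>

lemma card_image_le_card_exits:
  fixes f g :: "int \<times> int \<Rightarrow> int"
  assumes "finite A" and const: "\<And>p. f (p + d) = f p" and incr: "\<And>p. g p < g (p + d)"
  shows "card (f ` A) \<le> card (exits A d)"
proof -
  have "f ` A \<subseteq> f ` exits A d"
  proof
    fix v assume "v \<in> f ` A"
    let ?L = "{p \<in> A. f p = v}"
    have fin: "finite (g ` ?L)" "g ` ?L \<noteq> {}"
      using \<open>finite A\<close> \<open>v \<in> f ` A\<close> by auto
    then obtain p where p: "p \<in> ?L" "g p = Max (g ` ?L)"
      using Max_in[OF fin] by (smt (verit) imageE)
    have "p + d \<notin> ?L"
      using Max_ge[OF fin(1), of "g (p + d)"] p(2) incr[of p] by auto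
    then show "v \<in> f ` exits A d"
      using p(1) const[of p] by (intro image_eqI[of _ _ p]) (auto simp: exits_def)
  qed
  moreover have "finite (exits A d)"
    using \<open>finite A\<close> by (simp add: exits_def)
  ultimately show ?thesis
    by (meson card_image_le card_mono finite_imageI le_trans)
qed

lemma sum_dirs:
  "(\<Sum>d\<in>dirs. h d) = h (1, 0) + h (-1, 0) + h (0, 1) + h (0, -1) + h (1, -1) + h (-1, 1)"
  for h :: "int \<times> int \<Rightarrow> nat"
  by (simp add: dirs_def)

lemma card_edge_boundary_ge:
  assumes "finite A"
  shows "card (edge_boundary (pt ` A))
    \<ge> 2 * (card (fst ` A) + card (snd ` A) + card ((\<lambda>p. fst p + snd p) ` A))"
proof -
  note * = card_image_le_card_exits[OF assms]
  have "card (snd ` A) \<le> card (exits A (1, 0))" by (rule *[where g = fst]) auto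
  moreover have "card (snd ` A) \<le> card (exits A (-1, 0))"
    by (rule *[where g = "\<lambda>p. - fst p"]) auto
  moreover have "card (fst ` A) \<le> card (exits A (0, 1))" by (rule *[where g = snd]) auto
  moreover have "card (fst ` A) \<le> card (exits A (0, -1))"
    by (rule *[where g = "\<lambda>p. - snd p"]) auto
  moreover have "card ((\<lambda>p. fst p + snd p) ` A) \<le> card (exits A (1, -1))"
    by (rule *[where g = fst]) auto
  moreover have "card ((\<lambda>p. fst p + snd p) ` A) \<le> card (exits A (-1, 1))"
    by (rule *[where g = snd]) auto
  ultimately show ?thesis
    unfolding card_edge_boundary_pt[OF assms] sum_dirs mult_2 by linarith
qed

section \<open>Cardinality bounds from three projections\<close>

text \<open>
  Induction on the number \<open>t\<close> of hooks. Walking along a hook, from the left end of the bottom row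
  to the corner and up the last column, \<open>fst + snd\<close> increases strictly: the row contributes sums at
  most \<open>x + y\<close>, the column sums at least \<open>x + y\<close>. So the hook has at most \<open>c\<close> points, and what is
  left lies in a grid with one column and one row less. The case \<open>t = 0\<close> is the trivial bound by the
  size of the grid.
\<close>

lemma card_le_hooks:
  fixes A :: "(int \<times> int) set"
  assumes "finite X" "finite Y" "A \<subseteq> X \<times> Y" "t \<le> card X" "t \<le> card Y"
    "card ((\<lambda>p. fst p + snd p) ` A) \<le> c"
  shows "card A \<le> c * t + (card X - t) * (card Y - t)"
  using assms
proof (induction t arbitrary: A X Y)
  case 0
  then show ?case
    using card_mono[of "X \<times> Y" A] by (simp add: card_cartesian_product)
next
  case (Suc t)
  let ?\<sigma> = "\<lambda>p::int \<times> int. fst p + snd p"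
  have "finite A"
    using Suc.prems by (meson finite_SigmaI finite_subset)
  have ne: "X \<noteq> {}" "Y \<noteq> {}" using Suc.prems by auto
  define x y where "x = Max X" and "y = Min Y"
  have x: "x \<in> X" "\<And>u. u \<in> X \<Longrightarrow> u \<le> x" and y: "y \<in> Y" "\<And>v. v \<in> Y \<Longrightarrow> y \<le> v"
    using ne Suc.prems by (auto simp: x_def y_def)
  define H where "H = {p \<in> A. fst p = x \<or> snd p = y}"
  \<comment> \<open>Two points in the same arm are separated by \<open>?\<sigma>\<close> directly; points in different arms can only
    have the same sum if both are the corner \<open>(x, y)\<close>.\<close>
  have "inj_on ?\<sigma> H"
  proof (rule inj_onI)
    fix p q assume pq: "p \<in> H" "q \<in> H" "?\<sigma> p = ?\<sigma> q"
    then have "fst p \<le> x" "fst q \<le> x" "y \<le> snd p" "y \<le> snd q"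
      using x(2) y(2) Suc.prems(3) by (auto simp: H_def)
    with pq show "p = q"
      by (auto simp: H_def prod_eq_iff)
  qed
  then have "card H = card (?\<sigma> ` H)" by (simp add: card_image)
  also have "\<dots> \<le> card (?\<sigma> ` A)"
    using \<open>finite A\<close> by (intro card_mono) (auto simp: H_def)
  finally have H: "card H \<le> c" using Suc.prems by simp
  have "card (A - H) \<le> c * t + (card (X - {x}) - t) * (card (Y - {y}) - t)"
  proof (rule Suc.IH)
    show "A - H \<subseteq> (X - {x}) \<times> (Y - {y})"
      using Suc.prems(3) by (auto simp: H_def)
    have "card (?\<sigma> ` (A - H)) \<le> card (?\<sigma> ` A)"
      using \<open>finite A\<close> by (intro card_mono) auto
    then show "card (?\<sigma> ` (A - H)) \<le> c" using Suc.prems by simp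
  qed (use Suc.prems x(1) y(1) in auto)
  moreover have "card A \<le> card H + card (A - H)"
    using \<open>finite A\<close> card_Un_le[of H "A - H"] by (simp add: H_def Un_absorb1)
  moreover have "card (X - {x}) - t = card X - Suc t" "card (Y - {y}) - t = card Y - Suc t"
    using Suc.prems x(1) y(1) by auto
  ultimately show ?case
    using H by simp
qed

text \<open>
  The hexagonal case, where \<open>a\<close>, \<open>b\<close>, \<open>c\<close> satisfy the triangle inequalities, is the one in which
  the minimizer \<open>(a + b - c) / 2\<close> is an admissible number of hooks; with \<open>r\<close> the parity of
  \<open>a + b - c\<close>, the slack is twice the sum of the squared differences of \<open>a\<close>, \<open>b\<close>, \<open>c\<close> plus
  \<open>3 (1 - r)\<close>, which vanishes for \<open>a = b = c\<close> odd. In the other cases one number is larger than the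
  sum of the other two, and peeling no hooks or as many as possible bounds \<open>n\<close> by the product of
  the two small ones.
\<close>

lemma hook_bound_imp_isoperimetric:
  fixes a b c n :: nat
  assumes hook: "\<And>t. t \<le> a \<Longrightarrow> t \<le> b \<Longrightarrow> n \<le> c * t + (a - t) * (b - t)"
  shows "12 * int n \<le> (int a + int b + int c)\<^sup>2 + 3"
proof -
  have degenerate: "12 * int n \<le> (int u + int v + int w)\<^sup>2 + 3"
    if "n \<le> u * v" "u + v \<le> w" for u v w :: nat
  proof -
    have "int n \<le> int u * int v"
      using that(1) by (simp flip: of_nat_mult)
    moreover have "0 \<le> int u * int v" by simp
    moreover have "(2 * (int u + int v))\<^sup>2 \<le> (int u + int v + int w)\<^sup>2"
      using that(2) by (intro power_mono) auto
    moreover have "(2 * (int u + int v))\<^sup>2 = 16 * (int u * int v) + 4 * (int u - int v)\<^sup>2"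
      by (simp add: power2_eq_square algebra_simps)
    ultimately show ?thesis
      using zero_le_power2[of "int u - int v"] by linarith
  qed
  consider "a + b < c" | "b + c < a" | "a + c < b"
    | (hexagonal) "c \<le> a + b" "a \<le> b + c" "b \<le> a + c" by linarith
  then show ?thesis
  proof cases
    case 1
    then show ?thesis
      using degenerate[of a b c] hook[of 0] by simp
  next
    case 2
    then show ?thesis
      using degenerate[of c b a] hook[of b] by (simp add: ac_simps)
  next
    case 3
    then show ?thesis
      using degenerate[of c a b] hook[of a] by (simp add: ac_simps)
  next
    case hexagonal
    define t where "t = (a + b - c) div 2"
    define r where "r = (a + b - c) mod 2"
    have t: "t \<le> a" "t \<le> b" using hexagonal by (auto simp: t_def)
    have "a + b - c = 2 * t + r" by (simp add: t_def r_def)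
    then have c: "int c = int a + int b - 2 * int t - int r" using hexagonal by linarith
    define M where "M = int c * int t + (int a - int t) * (int b - int t)"
    have "int n \<le> M"
      using hook[OF t] t by (simp add: M_def flip: of_nat_mult of_nat_add of_nat_diff)
    moreover have "(int a + int b + int c)\<^sup>2 + 3 * (int r)\<^sup>2 - 12 * M
      = 2 * (int a - int b)\<^sup>2 + 2 * (int b - int c)\<^sup>2 + 2 * (int c - int a)\<^sup>2"
      unfolding M_def c by (simp add: power2_eq_square algebra_simps)
    moreover have "(int r)\<^sup>2 \<le> 1" by (simp add: r_def mod2_eq_if)
    ultimately show ?thesis
      using zero_le_power2[of "int a - int b"] zero_le_power2[of "int b - int c"]
        zero_le_power2[of "int c - int a"] by linarith
  qed
qed

text \<open>
  This is the claimed estimate with the denominator cleared and the terms linear in the boundary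
  count cancelled.
\<close>

lemma edge_isoperimetric:
  assumes "finite \<Omega>" "\<Omega> \<subseteq> tri_lattice"
  shows "48 * int (card \<Omega>) \<le> (int (card (edge_boundary \<Omega>)))\<^sup>2 + 12"
proof -
  obtain A where \<Omega>: "\<Omega> = pt ` A"
    using assms(2) unfolding tri_lattice_eq_range_pt by (meson subset_imageE)
  have "finite A"
    using assms(1) unfolding \<Omega> by (rule finite_imageD) (rule inj_on_subset[OF inj_pt], simp)
  define a b c where "a = card (fst ` A)" and "b = card (snd ` A)"
    and "c = card ((\<lambda>p. fst p + snd p) ` A)"
  have "12 * int (card A) \<le> (int a + int b + int c)\<^sup>2 + 3"
  proof (rule hook_bound_imp_isoperimetric)
    fix t assume "t \<le> a" "t \<le> b"
    moreover have "A \<subseteq> fst ` A \<times> snd ` A"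
      by (simp add: subsetI mem_Times_iff)
    ultimately show "card A \<le> c * t + (a - t) * (b - t)"
      unfolding a_def b_def c_def using \<open>finite A\<close>
      by (intro card_le_hooks) auto
  qed
  moreover have "(2 * (int a + int b + int c))\<^sup>2 \<le> (int (card (edge_boundary \<Omega>)))\<^sup>2"
    using card_edge_boundary_ge[OF \<open>finite A\<close>] unfolding \<Omega> a_def b_def c_def
    by (intro power_mono) simp_all
  moreover have "card \<Omega> = card A"
    unfolding \<Omega> by (rule card_image) (rule inj_on_subset[OF inj_pt], simp)
  ultimately show ?thesis unfolding power_mult_distrib by simp
qed

section \<open>Sharpness for hexagons\<close>

definition hex_coords :: "nat \<Rightarrow> (int \<times> int) set" where
  "hex_coords k = {(a, b). \<bar>a\<bar> \<le> int k \<and> \<bar>b\<bar> \<le> int k \<and> \<bar>a + b\<bar> \<le> int k}"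

lemma unit_vectors_eq: "{u \<in> tri_lattice. norm u = 1} = pt ` dirs"
  by (auto simp: tri_lattice_eq_range_pt norm_pt_eq_1_iff)

text \<open>
  The condition is \<open>\<alpha> + \<beta> \<le> r\<close> rather than \<open>\<alpha> + \<beta> = r\<close> because the origin, the midpoint of
  \<open>r w\<close> and \<open>- r w\<close>, lies in the hull. The case \<open>r = 0\<close> is included so that the hexagon consisting
  of a single vertex needs no separate treatment.
\<close>

lemma scaled_hull_two:
  fixes S :: "'a::real_vector set"
  assumes "u \<in> S" "v \<in> S" "w \<in> S" "- w \<in> S" "0 \<le> \<alpha>" "0 \<le> \<beta>" "\<alpha> + \<beta> \<le> r"
  shows "\<alpha> *\<^sub>R u + \<beta> *\<^sub>R v \<in> convex hull ((*\<^sub>R) r ` S)"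
proof -
  let ?C = "convex hull ((*\<^sub>R) r ` S)"
  have in_hull: "r *\<^sub>R s \<in> ?C" if "s \<in> S" for s
    using that by (auto intro: hull_inc)
  have "(1/2) *\<^sub>R (r *\<^sub>R w) + (1/2) *\<^sub>R (r *\<^sub>R - w) \<in> ?C"
    using assms by (intro convexD[OF convex_convex_hull] in_hull) auto
  then have zero: "0 \<in> ?C" by simp
  show ?thesis
  proof (cases "\<alpha> + \<beta> = 0")
    case True
    then have "\<alpha> = 0" "\<beta> = 0" using assms by auto
    with zero show ?thesis by simp
  next
    case False
    define \<gamma> where "\<gamma> = \<alpha> + \<beta>"
    have "0 < \<gamma>" "\<gamma> \<le> r" using False assms by (auto simp: \<gamma>_def)
    let ?m = "(\<alpha> / \<gamma>) *\<^sub>R (r *\<^sub>R u) + (\<beta> / \<gamma>) *\<^sub>R (r *\<^sub>R v)"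
    have "?m \<in> ?C"
      using assms \<open>0 < \<gamma>\<close>
      by (intro convexD[OF convex_convex_hull] in_hull) (auto simp: \<gamma>_def simp flip: add_divide_distrib)
    then have "(\<gamma> / r) *\<^sub>R ?m + (1 - \<gamma> / r) *\<^sub>R 0 \<in> ?C"
      using \<open>0 < \<gamma>\<close> \<open>\<gamma> \<le> r\<close> by (intro convexD[OF convex_convex_hull _ zero]) auto
    then show ?thesis
      using \<open>0 < \<gamma>\<close> \<open>\<gamma> \<le> r\<close> by (simp add: scaleR_add_right)
  qed
qed

text \<open>
  One inclusion holds because the three strips \<open>\<bar>a\<bar> \<le> k\<close>, \<open>\<bar>b\<bar> \<le> k\<close>, \<open>\<bar>a + b\<bar> \<le> k\<close> are convex and
  contain the six corners. For the other, the six sectors spanned by neighbouring unit vectors cover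
  the plane, and in its sector a point of the three strips is a combination of the two unit vectors
  with nonnegative coefficients of sum at most \<open>k\<close>.
\<close>

lemma hexagon_eq: "hexagon k = pt ` hex_coords k"
proof
  let ?C = "convex hull ((\<lambda>u. real k *\<^sub>R u) ` pt ` dirs)"
  \<comment> \<open>The intersection of the strips in Euclidean coordinates: for \<open>z = pt (a, b)\<close> the three linear
    forms take the values \<open>a\<close>, \<open>b\<close> and \<open>a + b\<close>.\<close>
  define K :: "(real \<times> real) set" where
    "K = {z. \<bar>fst z - snd z / sqrt 3\<bar> \<le> k \<and> \<bar>2 * snd z / sqrt 3\<bar> \<le> k
              \<and> \<bar>fst z + snd z / sqrt 3\<bar> \<le> k}"
  have slab: "convex {z :: real \<times> real. \<bar>s * fst z + t * snd z\<bar> \<le> k}" for s t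
  proof -
    have "{z :: real \<times> real. \<bar>s * fst z + t * snd z\<bar> \<le> k} =
      {z. (s, t) \<bullet> z \<le> k} \<inter> {z. (s, t) \<bullet> z \<ge> - real k}"
      by (auto simp: inner_prod_def)
    then show ?thesis
      by (simp add: convex_Int convex_halfspace_le convex_halfspace_ge)
  qed
  have K_eq: "K = {z. \<bar>1 * fst z + (- 1 / sqrt 3) * snd z\<bar> \<le> k}
      \<inter> {z. \<bar>0 * fst z + (2 / sqrt 3) * snd z\<bar> \<le> k}
      \<inter> {z. \<bar>1 * fst z + (1 / sqrt 3) * snd z\<bar> \<le> k}"
    by (auto simp: K_def)
  have "convex K" unfolding K_eq by (intro convex_Int slab)
  have pt_K: "r *\<^sub>R pt (a, b) \<in> K \<longleftrightarrow> \<bar>r * a\<bar> \<le> k \<and> \<bar>r * b\<bar> \<le> k \<and> \<bar>r * (a + b)\<bar> \<le> k"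
    for a b :: int and r :: real
  proof -
    have "fst (r *\<^sub>R pt (a, b)) - snd (r *\<^sub>R pt (a, b)) / sqrt 3 = r * a"
      "2 * snd (r *\<^sub>R pt (a, b)) / sqrt 3 = r * b"
      "fst (r *\<^sub>R pt (a, b)) + snd (r *\<^sub>R pt (a, b)) / sqrt 3 = r * (a + b)"
      by (simp_all add: pt_def field_simps)
    then show ?thesis unfolding K_def mem_Collect_eq by (simp only:)
  qed
  have "?C \<subseteq> K"
    using \<open>convex K\<close> by (intro hull_minimal) (auto simp: dirs_def pt_K)
  show "hexagon k \<subseteq> pt ` hex_coords k"
  proof
    fix z assume z: "z \<in> hexagon k"
    then obtain a b where ab: "z = pt (a, b)"
      by (auto simp: hexagon_def tri_lattice_eq_range_pt)
    have "1 *\<^sub>R pt (a, b) \<in> K"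
      using z \<open>?C \<subseteq> K\<close> unfolding ab hexagon_def unit_vectors_eq by auto
    then have "(a, b) \<in> hex_coords k"
      unfolding pt_K hex_coords_def by simp linarith
    then show "z \<in> pt ` hex_coords k" using ab by simp
  qed
  show "pt ` hex_coords k \<subseteq> hexagon k"
  proof
    fix z assume "z \<in> pt ` hex_coords k"
    then obtain a b where ab: "z = pt (a, b)" "\<bar>a\<bar> \<le> int k" "\<bar>b\<bar> \<le> int k" "\<bar>a + b\<bar> \<le> int k"
      by (auto simp: hex_coords_def)
    have comb: "z \<in> ?C"
      if "u \<in> dirs" "v \<in> dirs" "0 \<le> i" "0 \<le> j" "i + j \<le> int k"
        "a = i * fst u + j * fst v" "b = i * snd u + j * snd v" for u v i j
    proof -
      have "real_of_int i *\<^sub>R pt u + real_of_int j *\<^sub>R pt v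
          \<in> convex hull ((*\<^sub>R) (real k) ` pt ` dirs)"
      proof (rule scaled_hull_two[where w = "pt (1, 0)"])
        have "- pt (1, 0) = pt (-1, 0)" by (simp add: pt_def)
        then show "- pt (1, 0) \<in> pt ` dirs" by (auto simp: dirs_def)
      qed (use that in \<open>auto simp: dirs_def\<close>)
      moreover have "z = real_of_int i *\<^sub>R pt u + real_of_int j *\<^sub>R pt v"
        using that by (simp add: ab pt_def algebra_simps add_divide_distrib)
      ultimately show ?thesis by simp
    qed
    consider "0 \<le> a" "0 \<le> b" | "a \<le> 0" "b \<le> 0" | "b \<le> 0" "0 \<le> a + b" | "0 \<le> a" "a + b \<le> 0"
      | "a \<le> 0" "0 \<le> a + b" | "0 \<le> b" "a + b \<le> 0" by linarith
    then have "z \<in> ?C"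
    proof cases
      case 1 then show ?thesis
        using ab by (intro comb[of "(1, 0)" "(0, 1)" a b]) (auto simp: dirs_def)
    next
      case 2 then show ?thesis
        using ab by (intro comb[of "(-1, 0)" "(0, -1)" "-a" "-b"]) (auto simp: dirs_def)
    next
      case 3 then show ?thesis
        using ab by (intro comb[of "(1, 0)" "(1, -1)" "a + b" "-b"]) (auto simp: dirs_def)
    next
      case 4 then show ?thesis
        using ab by (intro comb[of "(0, -1)" "(1, -1)" "-a - b" "a"]) (auto simp: dirs_def)
    next
      case 5 then show ?thesis
        using ab by (intro comb[of "(0, 1)" "(-1, 1)" "a + b" "-a"]) (auto simp: dirs_def)
    next
      case 6 then show ?thesis
        using ab by (intro comb[of "(-1, 0)" "(-1, 1)" "-a - b" "b"]) (auto simp: dirs_def)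
    qed
    then show "z \<in> hexagon k"
      unfolding hexagon_def unit_vectors_eq by (auto simp: ab tri_lattice_eq_range_pt)
  qed
qed

lemma hex_coords_Sigma:
  "hex_coords k = (SIGMA a:{- int k..int k}. {max (- int k) (- int k - a)..min (int k) (int k - a)})"
  by (auto simp: hex_coords_def)

lemma finite_hex_coords: "finite (hex_coords k)"
  by (simp add: hex_coords_Sigma)

lemma card_hex_coords: "int (card (hex_coords k)) = 3 * (int k)\<^sup>2 + 3 * int k + 1"
proof -
  have abs_sum: "(\<Sum>a\<in>{- int k..int k}. \<bar>a\<bar>) = int k * (int k + 1)"
  proof (induction k)
    case (Suc k)
    have "{- int (Suc k)..int (Suc k)} = insert (int k + 1) (insert (- int k - 1) {- int k..int k})"
      by auto
    then show ?case by (simp add: Suc algebra_simps)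
  qed simp
  have "int (card (hex_coords k)) = (\<Sum>a\<in>{- int k..int k}. 2 * int k + 1 - \<bar>a\<bar>)"
    unfolding hex_coords_Sigma by (auto intro!: sum.cong simp: max_def min_def)
  also have "\<dots> = (2 * int k + 1) * (2 * int k + 1) - int k * (int k + 1)"
    by (simp only: sum_subtractf abs_sum) simp
  finally show ?thesis by (simp add: power2_eq_square algebra_simps)
qed

text \<open>
  The hexagon meets each line of the three families in an interval, so it has one exit per direction
  on each of the \<open>2 k + 1\<close> lines.
\<close>

lemma card_edge_boundary_hexagon_le: "card (edge_boundary (hexagon k)) \<le> 12 * k + 6"
proof -
  have *: "card (exits (hex_coords k) d) \<le> 2 * k + 1"
    if "inj_on f (exits (hex_coords k) d)" "f ` hex_coords k \<subseteq> {- int k..int k}"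
    for f d
  proof -
    have "card (exits (hex_coords k) d) = card (f ` exits (hex_coords k) d)"
      using that(1) by (simp add: card_image)
    also have "\<dots> \<le> card {- int k..int k}"
      using that(2) by (intro card_mono) (auto simp: exits_def)
    finally show ?thesis by simp
  qed
  have "inj_on snd (exits (hex_coords k) (1, 0))"
    by (clarsimp simp: inj_on_def exits_def hex_coords_def) (smt (verit))
  then have "card (exits (hex_coords k) (1, 0)) \<le> 2 * k + 1"
    by (rule *) (auto simp: hex_coords_def)
  moreover
  have "inj_on snd (exits (hex_coords k) (-1, 0))"
    by (clarsimp simp: inj_on_def exits_def hex_coords_def) (smt (verit))
  then have "card (exits (hex_coords k) (-1, 0)) \<le> 2 * k + 1"
    by (rule *) (auto simp: hex_coords_def)
  moreover
  have "inj_on fst (exits (hex_coords k) (0, 1))"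
    by (clarsimp simp: inj_on_def exits_def hex_coords_def) (smt (verit))
  then have "card (exits (hex_coords k) (0, 1)) \<le> 2 * k + 1"
    by (rule *) (auto simp: hex_coords_def)
  moreover
  have "inj_on fst (exits (hex_coords k) (0, -1))"
    by (clarsimp simp: inj_on_def exits_def hex_coords_def) (smt (verit))
  then have "card (exits (hex_coords k) (0, -1)) \<le> 2 * k + 1"
    by (rule *) (auto simp: hex_coords_def)
  moreover
  have "inj_on (\<lambda>p. fst p + snd p) (exits (hex_coords k) (1, -1))"
    by (clarsimp simp: inj_on_def exits_def hex_coords_def) (smt (verit))
  then have "card (exits (hex_coords k) (1, -1)) \<le> 2 * k + 1"
    by (rule *) (auto simp: hex_coords_def)
  moreover
  have "inj_on (\<lambda>p. fst p + snd p) (exits (hex_coords k) (-1, 1))"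
    by (clarsimp simp: inj_on_def exits_def hex_coords_def) (smt (verit))
  then have "card (exits (hex_coords k) (-1, 1)) \<le> 2 * k + 1"
    by (rule *) (auto simp: hex_coords_def)
  ultimately show ?thesis
    unfolding hexagon_eq card_edge_boundary_pt[OF finite_hex_coords] sum_dirs by simp
qed

lemma finite_hexagon: "finite (hexagon k)"
  by (simp add: hexagon_eq finite_hex_coords)

lemma hexagon_subset: "hexagon k \<subseteq> tri_lattice"
  by (simp add: hexagon_def)

lemma card_hexagon: "int (card (hexagon k)) = 3 * (int k)\<^sup>2 + 3 * int k + 1"
  by (simp add: hexagon_eq card_hex_coords card_image inj_on_subset[OF inj_pt])

text \<open>
  The lower bound needs no count of edges: a smaller boundary would violate the isoperimetric
  inequality for the known number of vertices.
\<close>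

lemma card_edge_boundary_hexagon: "card (edge_boundary (hexagon k)) = 12 * k + 6"
proof (rule antisym)
  have "(int (12 * k + 6))\<^sup>2 = 48 * int (card (hexagon k)) - 12"
    unfolding card_hexagon by (simp add: power2_eq_square algebra_simps)
  also have "\<dots> \<le> (int (card (edge_boundary (hexagon k))))\<^sup>2"
    using edge_isoperimetric[OF finite_hexagon hexagon_subset, of k] by simp
  finally show "12 * k + 6 \<le> card (edge_boundary (hexagon k))"
    by (metis of_nat_0_le_iff of_nat_le_iff power2_le_imp_le)
qed (rule card_edge_boundary_hexagon_le)

section \<open>The isoperimetric inequality and its sharpness\<close>

(* The quotient is compared with 12 where its denominator is positive. The denominator can also be
   zero (a single vertex gives 0/0, a path gives m/0 with m > 0) or negative (two vertices at
   distance greater than 1 give 36/(-2)); for such sets the estimate is the one with the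
   denominator cleared. *)
theorem mainTheorem4:
  "(\<forall>\<Omega>. finite \<Omega> \<and> \<Omega> \<subseteq> tri_lattice \<longrightarrow>
      (real (card (edge_boundary \<Omega>)) - 6)\<^sup>2
        \<ge> 12 * (4 * real (card \<Omega>) - real (card (edge_boundary \<Omega>)) + 2) \<and>
      (4 * real (card \<Omega>) - real (card (edge_boundary \<Omega>)) + 2 > 0 \<longrightarrow>
        (real (card (edge_boundary \<Omega>)) - 6)\<^sup>2
          / (4 * real (card \<Omega>) - real (card (edge_boundary \<Omega>)) + 2) \<ge> 12)) \<and>
   (\<forall>k. finite (hexagon k) \<and> hexagon k \<subseteq> tri_lattice \<and>
      (real (card (edge_boundary (hexagon k))) - 6)\<^sup>2
        = 12 * (4 * real (card (hexagon k)) - real (card (edge_boundary (hexagon k))) + 2) \<and>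
      (k \<ge> 1 \<longrightarrow>
        (real (card (edge_boundary (hexagon k))) - 6)\<^sup>2
          / (4 * real (card (hexagon k)) - real (card (edge_boundary (hexagon k))) + 2) = 12))"
proof (intro conjI allI impI)
  have expand: "(P - 6)\<^sup>2 - 12 * (4 * N - P + 2) = P\<^sup>2 + 12 - 48 * N" for P N :: real
    by (simp add: power2_eq_square algebra_simps)
  {
    fix \<Omega> :: "(real \<times> real) set"
    assume \<Omega>: "finite \<Omega> \<and> \<Omega> \<subseteq> tri_lattice"
    let ?P = "real (card (edge_boundary \<Omega>))" and ?N = "real (card \<Omega>)"
    have "48 * int (card \<Omega>) \<le> (int (card (edge_boundary \<Omega>)))\<^sup>2 + 12"
      using \<Omega> by (intro edge_isoperimetric) auto
    then have "48 * ?N \<le> ?P\<^sup>2 + 12"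
      by (metis (mono_tags) of_int_add of_int_le_iff of_int_mult of_int_numeral of_int_of_nat_eq
          of_int_power)
    then show cleared: "(?P - 6)\<^sup>2 \<ge> 12 * (4 * ?N - ?P + 2)"
      using expand[of ?P ?N] by linarith
    assume "4 * ?N - ?P + 2 > 0"
    with cleared show "(?P - 6)\<^sup>2 / (4 * ?N - ?P + 2) \<ge> 12"
      by (simp add: pos_le_divide_eq)
  }
  fix k
  let ?P = "real (card (edge_boundary (hexagon k)))" and ?N = "real (card (hexagon k))"
  show "finite (hexagon k)" "hexagon k \<subseteq> tri_lattice"
    by (rule finite_hexagon hexagon_subset)+
  have P: "?P = 12 * real k + 6"
    by (simp add: card_edge_boundary_hexagon)
  have "real_of_int (int (card (hexagon k))) = 3 * (real k)\<^sup>2 + 3 * real k + 1"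
    unfolding card_hexagon by simp
  then have N: "?N = 3 * (real k)\<^sup>2 + 3 * real k + 1" by simp
  show cleared: "(?P - 6)\<^sup>2 = 12 * (4 * ?N - ?P + 2)"
    unfolding P N by (simp add: power2_eq_square algebra_simps)
  assume "1 \<le> k"
  then have "4 * ?N - ?P + 2 > 0"
    unfolding P N by (simp add: algebra_simps power2_eq_square)
  then show "(?P - 6)\<^sup>2 / (4 * ?N - ?P + 2) = 12"
    unfolding cleared by (simp del: distrib_left_numeral right_diff_distrib_numeral)
qed

end
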